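(* Let $M$ be a compact Riemannian manifold and let $1:M\to(0,\infty)^d$ be the roof function constant to one (i.e. equal to $(1,\dots,1)$). A bi-Lipschitz $\mathbb Z^d$-action $\varphi:\mathbb Z^d\times M\to M$ is expansive if and only if its suspension $\mathbb R^d$-action $\Phi:\mathbb R^d\times M_1\to M_1$ is expansive.
   Context: Here $d\ge 2$ is an integer, $\rho$ is the distance on $M$, $(e_i)_{i=1}^d$ is the canonical basis, and $f_i:=\varphi(e_i,\cdot)$, so $\varphi((n_1,\dots,n_d),x)=f_1^{n_1}\circ\cdots\circ f_d^{n_d}(x)$ (the $f_i$ commute). The action is bi-Lipschitz if the maps $f_i$ are bi-Lipschitz homeomorphisms. It is expansive if there is $\delta>0$ such that $\rho(\varphi(n,x),\varphi(n,y))<\delta$ for all $n\in\mathbb Z^d$ implies $x=y$. Suspension with roof function $1$: $M_1$ is the quotient of $M\times[0,1]^d$ by the equivalence relation generated by $(x,a_1,\dots,a_{i-1},1,a_{i+1},\dots,a_d)\sim(f_i(x),a_1,\dots,a_{i-1},0,a_{i+1},\dots,a_d)$ for all $x\in M$, $1\le i\le d$, $a_j\in[0,1]$. Every point has a unique representative with $(a_1,\dots,a_d)\in[0,1)^d$. The suspension action is $$\Phi((t_1,\dots,t_d),(x,a_1,\dots,a_d))=(f_1^{n_1}\circ\cdots\circ f_d^{n_d}(x),\,a_1+t_1-n_1,\dots,a_d+t_d-n_d),$$ where $n_i\in\mathbb Z$ is determined by $n_i\le a_i+t_i<n_i+1$. Metric on $M_1$ (compatible with the quotient topology): for points in the same slice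 $M\times\{(t_1,\dots,t_d)\}$, $t_i\in[0,1)$, put $$\rho_h((x,t_1,\dots,t_d),(y,t_1,\dots,t_d))=\sum_{\sigma\in\{0,1\}^d}\Big\{\prod_{i=1}^d[\sigma_it_i+(1-\sigma_i)(1-t_i)]\Big\}\rho(f_1^{\sigma_1}\circ\cdots\circ f_d^{\sigma_d}(x),f_1^{\sigma_1}\circ\cdots\circ f_d^{\sigma_d}(y)).$$ The distance between two points of $M_1$ is the infimum of $\sum_{i=1}^{n-1}\tilde d(\omega_i,\omega_{i+1})$ over finite sequences $\omega_1,\dots,\omega_n$ joining them such that consecutive points either lie in the same slice, with $\tilde d(\omega_i,\omega_{i+1})=\rho_h(\omega_i,\omega_{i+1})$, or lie in the same $\Phi$-orbit, with $\tilde d(\omega_i,\omega_{i+1})=\inf\{\|v\|:\Phi_v(\omega_i)=\omega_{i+1}\}$. The $\mathbb R^d$-action $\Phi$ on a compact metric space $(N,\mathrm{dist})$ is expansive if for every $\varepsilon>0$ there is $\delta>0$ such that if $x,y\in N$ satisfy $\mathrm{dist}(\Phi_v(x),\Phi_{h(v)}(y))<\delta$ for every $v\in\mathbb R^d$ for some continuous $h:\mathbb R^d\to\mathbb R^d$ with $h(0)=0$, then $y=\Phi_{v_0}(x)$ for some $v_0$ with $\|v_0\|<\varepsilon$. *)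

theory Defs
  imports "HOL-Analysis.Analysis"
begin

section \<open>Riemannian manifolds\<close>

text \<open>The manifold is the universe of a metric space type \<open>'m\<close>, whose \<open>dist\<close> is the distance on
  it, and charts take values in a Euclidean space \<open>'e\<close>.\<close>

primrec Ck_on :: "'a set \<Rightarrow> nat \<Rightarrow> ('a::real_normed_vector \<Rightarrow> 'b::real_normed_vector) \<Rightarrow> bool" where
  "Ck_on S 0 f \<longleftrightarrow> continuous_on S f"
| "Ck_on S (Suc k) f \<longleftrightarrow>
     (\<forall>x\<in>S. f differentiable at x) \<and> (\<forall>v. Ck_on S k (\<lambda>x. frechet_derivative f (at x) v))"

text \<open>Only meant for open sets \<open>S\<close>.\<close>

definition smooth_on :: "'a set \<Rightarrow> ('a::real_normed_vector \<Rightarrow> 'b::real_normed_vector) \<Rightarrow> bool" where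
  "smooth_on S f \<longleftrightarrow> (\<forall>k. Ck_on S k f)"

text \<open>A chart is a pair of its domain and its coordinate map (irrelevant outside the domain).\<close>

type_synonym ('m, 'e) chart = "'m set \<times> ('m \<Rightarrow> 'e)"

definition is_chart :: "('m::metric_space, 'e::euclidean_space) chart \<Rightarrow> bool" where
  "is_chart = (\<lambda>(U, \<psi>). open U \<and> open (\<psi> ` U) \<and> homeomorphism U (\<psi> ` U) \<psi> (inv_into U \<psi>))"

definition transition :: "('m, 'e) chart \<Rightarrow> ('m, 'e) chart \<Rightarrow> 'e \<Rightarrow> 'e" where
  "transition c c' = snd c' \<circ> inv_into (fst c) (snd c)"

definition smooth_atlas :: "('m::metric_space, 'e::euclidean_space) chart set \<Rightarrow> bool" where
  "smooth_atlas A \<longleftrightarrow>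
     (\<forall>c\<in>A. is_chart c) \<and> (\<Union>c\<in>A. fst c) = UNIV \<and>
     (\<forall>c\<in>A. \<forall>c'\<in>A. smooth_on (snd c ` (fst c \<inter> fst c')) (transition c c'))"

text \<open>\<open>g c p\<close> is the coordinate expression, in the chart \<open>c\<close>, of the inner product on the tangent
  space at \<open>p\<close>; the last conjunct is the transformation rule under a change of charts.\<close>

definition riemannian_metric ::
  "('m::metric_space, 'e::euclidean_space) chart set \<Rightarrow>
   (('m, 'e) chart \<Rightarrow> 'm \<Rightarrow> 'e \<Rightarrow> 'e \<Rightarrow> real) \<Rightarrow> bool" where
  "riemannian_metric A g \<longleftrightarrow>
     (\<forall>c\<in>A. \<forall>p\<in>fst c. bilinear (g c p) \<and> (\<forall>u v. g c p u v = g c p v u) \<and>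
        (\<forall>u. u \<noteq> 0 \<longrightarrow> g c p u u > 0)) \<and>
     (\<forall>c\<in>A. \<forall>u v. smooth_on (snd c ` fst c) (\<lambda>y. g c (inv_into (fst c) (snd c) y) u v)) \<and>
     (\<forall>c\<in>A. \<forall>c'\<in>A. \<forall>p\<in>fst c \<inter> fst c'. \<forall>u v.
        g c p u v =
        g c' p (frechet_derivative (transition c c') (at (snd c p)) u)
               (frechet_derivative (transition c c') (at (snd c p)) v))"

definition C1_curve_on ::
  "('m::metric_space, 'e::euclidean_space) chart set \<Rightarrow> real \<Rightarrow> real \<Rightarrow> (real \<Rightarrow> 'm) \<Rightarrow> bool" where
  "C1_curve_on A a b \<gamma> \<longleftrightarrow> continuous_on {a..b} \<gamma> \<and>
     (\<forall>(U, \<psi>)\<in>A.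
        (\<forall>s\<in>{a..b}. \<gamma> s \<in> U \<longrightarrow> (\<psi> \<circ> \<gamma>) differentiable (at s within {a..b})) \<and>
        continuous_on {s\<in>{a..b}. \<gamma> s \<in> U} (\<lambda>s. vector_derivative (\<psi> \<circ> \<gamma>) (at s within {a..b})))"

text \<open>By the transformation rule of \<open>g\<close>, the speed does not depend on the choice of the chart.\<close>

definition curve_speed ::
  "('m::metric_space, 'e::euclidean_space) chart set \<Rightarrow>
   (('m, 'e) chart \<Rightarrow> 'm \<Rightarrow> 'e \<Rightarrow> 'e \<Rightarrow> real) \<Rightarrow> real \<Rightarrow> real \<Rightarrow> (real \<Rightarrow> 'm) \<Rightarrow> real \<Rightarrow> real" where
  "curve_speed A g a b \<gamma> s =
     (let c = (SOME c. c \<in> A \<and> \<gamma> s \<in> fst c);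
          w = vector_derivative (snd c \<circ> \<gamma>) (at s within {a..b})
      in sqrt (g c (\<gamma> s) w w))"

definition curve_length ::
  "('m::metric_space, 'e::euclidean_space) chart set \<Rightarrow>
   (('m, 'e) chart \<Rightarrow> 'm \<Rightarrow> 'e \<Rightarrow> 'e \<Rightarrow> real) \<Rightarrow> real \<Rightarrow> real \<Rightarrow> (real \<Rightarrow> 'm) \<Rightarrow> real" where
  "curve_length A g a b \<gamma> = integral {a..b} (curve_speed A g a b \<gamma>)"

text \<open>Infimum of the lengths of the piecewise \<open>C\<^sup>1\<close> curves from \<open>p\<close> to \<open>q\<close>; \<open>t 0 < \<dots> < t n\<close> is a
  subdivision of the parameter interval such that the curve is \<open>C\<^sup>1\<close> on each closed piece.\<close>

definition riemannian_dist ::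
  "('m::metric_space, 'e::euclidean_space) chart set \<Rightarrow>
   (('m, 'e) chart \<Rightarrow> 'm \<Rightarrow> 'e \<Rightarrow> 'e \<Rightarrow> real) \<Rightarrow> 'm \<Rightarrow> 'm \<Rightarrow> real" where
  "riemannian_dist A g p q =
     Inf {\<Sum>i<n. curve_length A g (t i) (t (Suc i)) \<gamma> | (n::nat) (t :: nat \<Rightarrow> real) \<gamma>.
            \<gamma> (t 0) = p \<and> \<gamma> (t n) = q \<and>
            (\<forall>i<n. t i < t (Suc i) \<and> C1_curve_on A (t i) (t (Suc i)) \<gamma>)}"

text \<open>On a connected manifold, \<open>dist\<close> is the Riemannian distance. Connectedness is not assumed: if
  there are several components, \<open>dist\<close> is any metric of the manifold topology that is the Riemannian
  distance on each component.\<close>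

definition riemannian_manifold ::
  "('m::metric_space, 'e::euclidean_space) chart set \<Rightarrow>
   (('m, 'e) chart \<Rightarrow> 'm \<Rightarrow> 'e \<Rightarrow> 'e \<Rightarrow> real) \<Rightarrow> bool" where
  "riemannian_manifold A g \<longleftrightarrow> smooth_atlas A \<and> riemannian_metric A g \<and>
     (\<forall>p q. connected_component UNIV p q \<longrightarrow> dist p q = riemannian_dist A g p q)"

definition compact_riemannian_manifold ::
  "('m::metric_space, 'e::euclidean_space) chart set \<Rightarrow>
   (('m, 'e) chart \<Rightarrow> 'm \<Rightarrow> 'e \<Rightarrow> 'e \<Rightarrow> real) \<Rightarrow> bool" where
  "compact_riemannian_manifold A g \<longleftrightarrow> riemannian_manifold A g \<and> compact (UNIV :: 'm set)"

section \<open>Actions and expansiveness\<close>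

definition Zd_action :: "(int^'d \<Rightarrow> 'm \<Rightarrow> 'm) \<Rightarrow> bool" where
  "Zd_action \<phi> \<longleftrightarrow> (\<forall>x. \<phi> 0 x = x) \<and> (\<forall>m n x. \<phi> (m + n) x = \<phi> m (\<phi> n x))"

definition Zd_gen :: "(int^'d \<Rightarrow> 'm \<Rightarrow> 'm) \<Rightarrow> 'd \<Rightarrow> 'm \<Rightarrow> 'm" where
  "Zd_gen \<phi> i = \<phi> (axis i 1)"

definition bi_lipschitz_homeo :: "('m::metric_space \<Rightarrow> 'm) \<Rightarrow> bool" where
  "bi_lipschitz_homeo f \<longleftrightarrow>
     bij f \<and> (\<exists>L. L-lipschitz_on UNIV f) \<and> (\<exists>L. L-lipschitz_on UNIV (inv f))"

definition bi_lipschitz_action :: "(int^'d \<Rightarrow> 'm::metric_space \<Rightarrow> 'm) \<Rightarrow> bool" where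
  "bi_lipschitz_action \<phi> \<longleftrightarrow> (\<forall>i. bi_lipschitz_homeo (Zd_gen \<phi> i))"

definition Zd_expansive :: "(int^'d \<Rightarrow> 'm::metric_space \<Rightarrow> 'm) \<Rightarrow> bool" where
  "Zd_expansive \<phi> \<longleftrightarrow> (\<exists>\<delta>>0. \<forall>x y. (\<forall>n. dist (\<phi> n x) (\<phi> n y) < \<delta>) \<longrightarrow> x = y)"

definition Rd_expansive :: "'n set \<Rightarrow> ('n \<Rightarrow> 'n \<Rightarrow> real) \<Rightarrow> (real^'d \<Rightarrow> 'n \<Rightarrow> 'n) \<Rightarrow> bool" where
  "Rd_expansive N D \<Phi> \<longleftrightarrow>
     (\<forall>\<epsilon>>0. \<exists>\<delta>>0. \<forall>x\<in>N. \<forall>y\<in>N.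
        (\<exists>h :: real^'d \<Rightarrow> real^'d. continuous_on UNIV h \<and> h 0 = 0 \<and>
           (\<forall>v. D (\<Phi> v x) (\<Phi> (h v) y) < \<delta>)) \<longrightarrow>
        (\<exists>v0. norm v0 < \<epsilon> \<and> y = \<Phi> v0 x))"

section \<open>The suspension with roof function one\<close>

definition unit_cube :: "(real^'d) set" where
  "unit_cube = {a. \<forall>i. 0 \<le> a $ i \<and> a $ i \<le> 1}"

definition half_open_cube :: "(real^'d) set" where
  "half_open_cube = {a. \<forall>i. 0 \<le> a $ i \<and> a $ i < 1}"

definition susp_glue :: "(int^'d \<Rightarrow> 'm \<Rightarrow> 'm) \<Rightarrow> 'm \<times> (real^'d) \<Rightarrow> 'm \<times> (real^'d) \<Rightarrow> bool" where
  "susp_glue \<phi> = (\<lambda>(x, a) (y, b). a \<in> unit_cube \<and>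
     (\<exists>i. a $ i = 1 \<and> y = Zd_gen \<phi> i x \<and> b = (\<chi> j. if j = i then 0 else a $ j)))"

definition susp_eq :: "(int^'d \<Rightarrow> 'm \<Rightarrow> 'm) \<Rightarrow> (('m \<times> (real^'d)) \<times> ('m \<times> (real^'d))) set" where
  "susp_eq \<phi> = {(p, q). p \<in> UNIV \<times> unit_cube \<and> q \<in> UNIV \<times> unit_cube \<and> equivclp (susp_glue \<phi>) p q}"

definition suspension :: "(int^'d \<Rightarrow> 'm \<Rightarrow> 'm) \<Rightarrow> ('m \<times> (real^'d)) set set" where
  "suspension \<phi> = (UNIV \<times> unit_cube) // susp_eq \<phi>"

text \<open>The representative \<open>(x, a)\<close> of a point of the suspension with \<open>a \<in> [0,1)\<^sup>d\<close>; it exists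
  and is unique for points of \<open>suspension \<phi>\<close> when \<open>\<phi>\<close> is an action.\<close>

definition susp_rep :: "('m \<times> (real^'d)) set \<Rightarrow> 'm \<times> (real^'d)" where
  "susp_rep \<omega> = (THE p. p \<in> \<omega> \<and> snd p \<in> half_open_cube)"

definition susp_flow ::
  "(int^'d \<Rightarrow> 'm \<Rightarrow> 'm) \<Rightarrow> real^'d \<Rightarrow> ('m \<times> (real^'d)) set \<Rightarrow> ('m \<times> (real^'d)) set" where
  "susp_flow \<phi> t \<omega> =
     (let (x, a) = susp_rep \<omega>; n = (\<chi> i. \<lfloor>a $ i + t $ i\<rfloor>)
      in susp_eq \<phi> `` {(\<phi> n x, \<chi> i. a $ i + t $ i - of_int (n $ i))})"

definition same_slice :: "('m \<times> (real^'d)) set \<Rightarrow> ('m \<times> (real^'d)) set \<Rightarrow> bool" where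
  "same_slice \<omega> \<omega>' \<longleftrightarrow> snd (susp_rep \<omega>) = snd (susp_rep \<omega>')"

text \<open>Only meant for points in the same slice.\<close>

definition slice_dist ::
  "(int^'d \<Rightarrow> 'm::metric_space \<Rightarrow> 'm) \<Rightarrow> ('m \<times> (real^'d)) set \<Rightarrow> ('m \<times> (real^'d)) set \<Rightarrow> real" where
  "slice_dist \<phi> \<omega> \<omega>' =
     (let (x, t) = susp_rep \<omega>; y = fst (susp_rep \<omega>')
      in \<Sum>\<sigma> | \<forall>i. \<sigma> $ i \<in> {0, 1}.
           (\<Prod>i\<in>UNIV. of_int (\<sigma> $ i) * t $ i + (1 - of_int (\<sigma> $ i)) * (1 - t $ i)) *
           dist (\<phi> \<sigma> x) (\<phi> \<sigma> y))"

definition same_orbit ::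
  "(int^'d \<Rightarrow> 'm \<Rightarrow> 'm) \<Rightarrow> ('m \<times> (real^'d)) set \<Rightarrow> ('m \<times> (real^'d)) set \<Rightarrow> bool" where
  "same_orbit \<phi> \<omega> \<omega>' \<longleftrightarrow> (\<exists>v. susp_flow \<phi> v \<omega> = \<omega>')"

definition orbit_dist ::
  "(int^'d \<Rightarrow> 'm \<Rightarrow> 'm) \<Rightarrow> ('m \<times> (real^'d)) set \<Rightarrow> ('m \<times> (real^'d)) set \<Rightarrow> real" where
  "orbit_dist \<phi> \<omega> \<omega>' = Inf {norm v | v. susp_flow \<phi> v \<omega> = \<omega>'}"

text \<open>\<open>susp_step \<phi> \<omega> \<omega>' r\<close>: a step from \<open>\<omega>\<close> to \<open>\<omega>'\<close> of cost \<open>r\<close>. Points that are both in the same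
  slice and in the same orbit may be joined at either cost.\<close>

definition susp_step ::
  "(int^'d \<Rightarrow> 'm::metric_space \<Rightarrow> 'm) \<Rightarrow> ('m \<times> (real^'d)) set \<Rightarrow> ('m \<times> (real^'d)) set \<Rightarrow> real \<Rightarrow> bool" where
  "susp_step \<phi> \<omega> \<omega>' r \<longleftrightarrow>
     same_slice \<omega> \<omega>' \<and> r = slice_dist \<phi> \<omega> \<omega>' \<or>
     same_orbit \<phi> \<omega> \<omega>' \<and> r = orbit_dist \<phi> \<omega> \<omega>'"

definition susp_dist ::
  "(int^'d \<Rightarrow> 'm::metric_space \<Rightarrow> 'm) \<Rightarrow> ('m \<times> (real^'d)) set \<Rightarrow> ('m \<times> (real^'d)) set \<Rightarrow> real" where
  "susp_dist \<phi> p q =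
     Inf {\<Sum>i<n. r i | (n::nat) \<omega> r.
            \<omega> 0 = p \<and> \<omega> n = q \<and> (\<forall>i\<le>n. \<omega> i \<in> suspension \<phi>) \<and>
            (\<forall>i<n. susp_step \<phi> (\<omega> i) (\<omega> (Suc i)) (r i))}"

end

theory Submission
  imports Defs
begin

text \<open>The suspension is the orbit space of \<open>M \<times> \<real>\<^sup>d\<close> under the deck transformations
  \<open>(x, s) \<mapsto> (\<phi> n x, s - n)\<close>, and the suspension flow is the translation of the height
  \<open>s\<close>. In these coordinates both implications become short.

  If the flow is expansive, two points of \<open>M\<close> whose \<open>\<phi>\<close>-orbits stay close give two points of
  height \<open>0\<close> whose flow orbits stay close, because the slice distance is a weighted sum of
  distances along the \<open>\<phi>\<close>-orbits. Hence they differ by a short translation, and between points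
  of height \<open>0\<close> a short translation is trivial.

  The converse rests on one property of the chain metric (\<open>susp_dist_less_lift\<close>). A cheap chain lifts
  to a chain in \<open>M \<times> \<real>\<^sup>d\<close> whose orbit steps change only the height, by a small total amount,
  and whose slice steps change only the point of \<open>M\<close>. Near an integer height one corner of the
  cube has weight at least \<open>2\<^sup>-\<^sup>d\<close> in the slice distance, so the total displacement in
  \<open>M\<close> is also small. Now let the flow orbits of \<open>p\<close> and \<open>q\<close> stay close up to a
  reparametrization \<open>h\<close>. The difference of their heights is a continuous function of the time \<open>v\<close>
  that stays close to integer vectors, so it stays close to a single one
  (\<open>int_vec_near_continuous_constant\<close>). Applying the corresponding deck transformation to \<open>q\<close>, the
  heights agree up to a small error at all times, and the times at which the height of \<open>p\<close> is an
  integer vector show that the base points have close \<open>\<phi>\<close>-orbits. By expansiveness of \<open>\<phi>\<close>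
  they are equal, so \<open>p\<close> and \<open>q\<close> differ by a translation, namely the small difference of
  heights at time \<open>0\<close>.\<close>

section \<open>Integer and fractional parts of vectors\<close>

definition floor_vec :: "real^'d \<Rightarrow> int^'d" where
  "floor_vec s = (\<chi> i. \<lfloor>s $ i\<rfloor>)"

definition int_vec :: "int^'d \<Rightarrow> real^'d" where
  "int_vec n = (\<chi> i. of_int (n $ i))"

definition frac_vec :: "real^'d \<Rightarrow> real^'d" where
  "frac_vec s = s - int_vec (floor_vec s)"

lemma floor_vec_nth [simp]: "floor_vec s $ i = \<lfloor>s $ i\<rfloor>"
  by (simp add: floor_vec_def)

lemma int_vec_nth [simp]: "int_vec n $ i = of_int (n $ i)"
  by (simp add: int_vec_def)

lemma frac_vec_nth [simp]: "frac_vec s $ i = frac (s $ i)"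
  by (simp add: frac_vec_def frac_def)

lemma floor_vec_add_int_vec [simp]: "floor_vec (s + int_vec n) = floor_vec s + n"
  by (simp add: vec_eq_iff)

lemma frac_vec_add_int_vec [simp]: "frac_vec (s + int_vec n) = frac_vec s"
  by (simp add: vec_eq_iff frac_def)

lemma frac_vec_decomp: "s = frac_vec s + int_vec (floor_vec s)"
  by (simp add: frac_vec_def)

lemma int_vec_simps:
  "int_vec 0 = 0" "int_vec (m + n) = int_vec m + int_vec n" "int_vec (m - n) = int_vec m - int_vec n"
  by (simp_all add: vec_eq_iff)

lemma frac_vec_mem: "frac_vec s \<in> half_open_cube"
  by (simp add: half_open_cube_def frac_lt_1)

lemma half_open_cube_fixed:
  assumes "a \<in> half_open_cube"
  shows "floor_vec a = 0" "frac_vec a = a"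
proof -
  have *: "\<lfloor>a $ i\<rfloor> = 0" for i
    using assms by (simp add: half_open_cube_def floor_eq_iff)
  show "floor_vec a = 0" by (simp add: vec_eq_iff *)
  show "frac_vec a = a" by (simp add: vec_eq_iff frac_def *)
qed

lemma half_open_cube_subset: "half_open_cube \<subseteq> unit_cube"
  by (auto simp: half_open_cube_def unit_cube_def less_imp_le)

lemma int_vec_eq_if_close:
  assumes "norm (int_vec m - int_vec n) < 1"
  shows "m = n"
proof -
  have "\<bar>of_int (m $ i) - of_int (n $ i) :: real\<bar> < 1" for i
    using component_le_norm_cart[of "int_vec m - int_vec n" i] assms by simp
  then have "m $ i = n $ i" for i
    by (smt (verit) of_int_diff of_int_abs of_int_less_1_iff)
  then show ?thesis by (simp add: vec_eq_iff)
qed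

section \<open>The weights of the corners of the cube\<close>

definition corner_weight :: "int^'d \<Rightarrow> real^'d \<Rightarrow> real" where
  "corner_weight \<sigma> t =
     (\<Prod>i\<in>UNIV. of_int (\<sigma> $ i) * t $ i + (1 - of_int (\<sigma> $ i)) * (1 - t $ i))"

definition corners :: "(int^'d) set" where
  "corners = {\<sigma>. \<forall>i. \<sigma> $ i \<in> {0, 1}}"

lemma finite_corners: "finite (corners :: (int^'d) set)"
proof (rule finite_subset)
  show "corners \<subseteq> (\<lambda>f. \<chi> i. f i) ` ((UNIV :: 'd set) \<rightarrow>\<^sub>E {0, 1})"
  proof
    fix \<sigma> :: "int^'d" assume "\<sigma> \<in> corners"
    then have "($) \<sigma> \<in> (UNIV \<rightarrow>\<^sub>E {0, 1})" by (auto simp: corners_def)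
    moreover have "\<sigma> = (\<chi> i. \<sigma> $ i)" by simp
    ultimately show "\<sigma> \<in> (\<lambda>f. \<chi> i. f i) ` (UNIV \<rightarrow>\<^sub>E {0, 1})" by blast
  qed
  show "finite ((\<lambda>f. \<chi> i. f i) ` ((UNIV :: 'd set) \<rightarrow>\<^sub>E {0, 1 :: int}))"
    by (intro finite_imageI finite_PiE) auto
qed

lemma corner_weight_bounds:
  assumes "\<sigma> \<in> corners" "t \<in> half_open_cube"
  shows "0 \<le> corner_weight \<sigma> t" "corner_weight \<sigma> t \<le> 1"
proof -
  have "0 \<le> of_int (\<sigma> $ i) * t $ i + (1 - of_int (\<sigma> $ i)) * (1 - t $ i) \<and>
      of_int (\<sigma> $ i) * t $ i + (1 - of_int (\<sigma> $ i)) * (1 - t $ i) \<le> 1" for i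
  proof -
    have "\<sigma> $ i = 0 \<or> \<sigma> $ i = 1" "0 \<le> t $ i" "t $ i < 1"
      using assms by (auto simp: corners_def half_open_cube_def)
    then show ?thesis by auto
  qed
  then show "0 \<le> corner_weight \<sigma> t" "corner_weight \<sigma> t \<le> 1"
    unfolding corner_weight_def by (auto intro!: prod_nonneg prod_le_1)
qed

section \<open>The suspension as a quotient of \<open>M \<times> \<real>\<^sup>d\<close>\<close>

definition susp_normal :: "(int^'d \<Rightarrow> 'm \<Rightarrow> 'm) \<Rightarrow> 'm \<times> (real^'d) \<Rightarrow> 'm \<times> (real^'d)" where
  "susp_normal \<phi> = (\<lambda>(x, s). (\<phi> (floor_vec s) x, frac_vec s))"

text \<open>The projection \<open>M \<times> \<real>\<^sup>d \<rightarrow> M\<^sub>1\<close>, where \<open>M\<^sub>1\<close> is seen as the orbit space of the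
  \<open>\<int>\<^sup>d\<close>-action \<open>n \<cdot> (x, s) = (\<phi> n x, s - n)\<close>. In these coordinates the suspension flow is
  just the translation of the second factor.\<close>

definition susp_point :: "(int^'d \<Rightarrow> 'm \<Rightarrow> 'm) \<Rightarrow> 'm \<Rightarrow> real^'d \<Rightarrow> ('m \<times> (real^'d)) set" where
  "susp_point \<phi> x s = susp_eq \<phi> `` {susp_normal \<phi> (x, s)}"

lemma susp_normal_mem: "susp_normal \<phi> p \<in> UNIV \<times> unit_cube"
  using half_open_cube_subset frac_vec_mem by (auto simp: susp_normal_def split: prod.split)

locale Zd_act =
  fixes \<phi> :: "int^'d \<Rightarrow> 'm::metric_space \<Rightarrow> 'm"
  assumes action: "Zd_action \<phi>"
begin

lemma phi_0 [simp]: "\<phi> 0 x = x"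
  using action by (simp add: Zd_action_def)

lemma phi_add: "\<phi> (m + n) x = \<phi> m (\<phi> n x)"
  using action by (simp add: Zd_action_def)

lemma phi_inj: "\<phi> n x = \<phi> n y \<longleftrightarrow> x = y"
  using phi_add[of "-n" n] by (metis add.left_inverse phi_0)

lemma susp_normal_glue:
  assumes "susp_glue \<phi> p q"
  shows "susp_normal \<phi> p = susp_normal \<phi> q"
proof -
  obtain x a where p: "p = (x, a)" by fastforce
  obtain i where i: "a $ i = 1"
    and q: "q = (Zd_gen \<phi> i x, \<chi> j. if j = i then 0 else a $ j)"
    using assms by (cases q) (auto simp: susp_glue_def p)
  have a: "a = (\<chi> j. if j = i then 0 else a $ j) + int_vec (axis i 1)"
    using i by (simp add: vec_eq_iff axis_def)
  have "susp_normal \<phi> (x, a) = susp_normal \<phi> (\<phi> (axis i 1) x, \<chi> j. if j = i then 0 else a $ j)"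
    by (subst a) (simp add: susp_normal_def phi_add)
  then show ?thesis by (simp add: p q Zd_gen_def)
qed

lemma equivclp_susp_glue_imp_normal_eq:
  "equivclp (susp_glue \<phi>) p q \<Longrightarrow> susp_normal \<phi> p = susp_normal \<phi> q"
  by (induction rule: equivclp_induct) (metis susp_normal_glue)+

text \<open>Each coordinate that equals \<open>1\<close> can be turned into \<open>0\<close> by one gluing, and the gluings do
  not change the normal form.\<close>

lemma equivclp_susp_normal:
  "a \<in> unit_cube \<Longrightarrow> equivclp (susp_glue \<phi>) (x, a) (susp_normal \<phi> (x, a))"
proof (induction "card {i. a $ i = 1}" arbitrary: x a)
  case 0
  then have "a $ i \<noteq> 1" for i by auto
  with 0 have "a \<in> half_open_cube"
    by (auto simp: half_open_cube_def unit_cube_def less_le)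
  then show ?case by (simp add: susp_normal_def half_open_cube_fixed)
next
  case (Suc k)
  then obtain i where i: "a $ i = 1"
    by (metis (mono_tags, lifting) card_gt_0_iff ex_in_conv mem_Collect_eq zero_less_Suc)
  define b where "b = (\<chi> j. if j = i then 0 else a $ j)"
  have "{j. b $ j = 1} = {j. a $ j = 1} - {i}" by (auto simp: b_def)
  then have "card {j. b $ j = 1} = k" using Suc.hyps(2) i by simp
  moreover have b: "b \<in> unit_cube" using Suc.prems by (auto simp: b_def unit_cube_def)
  ultimately have "equivclp (susp_glue \<phi>) (Zd_gen \<phi> i x, b) (susp_normal \<phi> (Zd_gen \<phi> i x, b))"
    using Suc.hyps(1) by blast
  moreover have glue: "susp_glue \<phi> (x, a) (Zd_gen \<phi> i x, b)"
    using Suc.prems i by (auto simp: susp_glue_def b_def)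
  ultimately show ?case
    by (metis equivclp_trans r_into_equivclp susp_normal_glue)
qed

lemma susp_eq_iff:
  "(p, q) \<in> susp_eq \<phi> \<longleftrightarrow>
     p \<in> UNIV \<times> unit_cube \<and> q \<in> UNIV \<times> unit_cube \<and> susp_normal \<phi> p = susp_normal \<phi> q"
proof -
  have "equivclp (susp_glue \<phi>) p q" if "susp_normal \<phi> p = susp_normal \<phi> q"
      "p \<in> UNIV \<times> unit_cube" "q \<in> UNIV \<times> unit_cube"
    using that equivclp_susp_normal[of "snd p" "fst p"] equivclp_susp_normal[of "snd q" "fst q"]
    by (auto intro: equivclp_trans[OF _ equivclp_sym])
  then show ?thesis
    using equivclp_susp_glue_imp_normal_eq[of p q] unfolding susp_eq_def by blast
qed

lemma susp_normal_fixed: "snd p \<in> half_open_cube \<Longrightarrow> susp_normal \<phi> p = p"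
  by (cases p) (simp add: susp_normal_def half_open_cube_fixed)

lemma susp_normal_idem: "susp_normal \<phi> (susp_normal \<phi> p) = susp_normal \<phi> p"
  by (rule susp_normal_fixed) (simp add: susp_normal_def frac_vec_mem split: prod.split)

lemma susp_point_eq_set:
  "susp_point \<phi> x s = {q \<in> UNIV \<times> unit_cube. susp_normal \<phi> q = susp_normal \<phi> (x, s)}"
  unfolding susp_point_def using susp_normal_mem[of \<phi> "(x, s)"]
  by (intro set_eqI) (simp only: Image_singleton_iff susp_eq_iff susp_normal_idem mem_Collect_eq, metis)

lemma susp_rep_point: "susp_rep (susp_point \<phi> x s) = susp_normal \<phi> (x, s)"
  unfolding susp_rep_def
proof (rule the_equality)
  show "susp_normal \<phi> (x, s) \<in> susp_point \<phi> x s \<and> snd (susp_normal \<phi> (x, s)) \<in> half_open_cube"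
    using susp_normal_mem[of \<phi> "(x, s)"]
    by (simp add: susp_point_eq_set susp_normal_idem) (simp add: susp_normal_def frac_vec_mem)
next
  fix p assume "p \<in> susp_point \<phi> x s \<and> snd p \<in> half_open_cube"
  then show "p = susp_normal \<phi> (x, s)"
    using susp_normal_fixed by (auto simp: susp_point_eq_set)
qed

lemma susp_point_eq_iff:
  "susp_point \<phi> x s = susp_point \<phi> y t \<longleftrightarrow> susp_normal \<phi> (x, s) = susp_normal \<phi> (y, t)"
  by (metis susp_rep_point susp_point_def)

lemma susp_point_shift: "susp_point \<phi> x (s + int_vec n) = susp_point \<phi> (\<phi> n x) s"
  by (simp add: susp_point_eq_iff susp_normal_def phi_add)

lemma susp_point_inj: "susp_point \<phi> x s = susp_point \<phi> y s \<longleftrightarrow> x = y"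
  by (simp add: susp_point_eq_iff susp_normal_def phi_inj)

lemma susp_point_mem: "susp_point \<phi> x s \<in> suspension \<phi>"
  unfolding susp_point_def suspension_def by (rule quotientI) (rule susp_normal_mem)

lemma suspension_cases:
  assumes "\<omega> \<in> suspension \<phi>"
  obtains x s where "\<omega> = susp_point \<phi> x s"
proof -
  obtain p where p: "p \<in> UNIV \<times> unit_cube" "\<omega> = susp_eq \<phi> `` {p}"
    using assms by (auto simp: suspension_def elim: quotientE)
  then have "\<omega> = susp_point \<phi> (fst p) (snd p)"
    by (auto simp: susp_point_eq_set susp_eq_iff)
  then show thesis by (rule that)
qed

lemma susp_flow_point: "susp_flow \<phi> t (susp_point \<phi> x s) = susp_point \<phi> x (s + t)"
proof -
  have "susp_flow \<phi> t (susp_point \<phi> x s) = susp_point \<phi> (\<phi> (floor_vec s) x) (frac_vec s + t)"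
    unfolding susp_flow_def susp_rep_point
    by (simp add: susp_normal_def susp_point_def floor_vec_def frac_vec_def int_vec_def
        minus_vec_def plus_vec_def)
  also have "\<dots> = susp_point \<phi> x (frac_vec s + t + int_vec (floor_vec s))"
    by (simp only: susp_point_shift)
  also have "frac_vec s + t + int_vec (floor_vec s) = s + t"
    by (simp add: frac_vec_def)
  finally show ?thesis .
qed

lemma same_slice_point: "same_slice (susp_point \<phi> x s) (susp_point \<phi> y t) \<longleftrightarrow> frac_vec s = frac_vec t"
  by (simp add: same_slice_def susp_rep_point susp_normal_def)

lemma same_slice_imp_lift:
  assumes "same_slice (susp_point \<phi> x s) \<omega>" "\<omega> \<in> suspension \<phi>"
  obtains y where "\<omega> = susp_point \<phi> y s"
proof -
  obtain y t where \<omega>: "\<omega> = susp_point \<phi> y t" using assms(2) by (rule suspension_cases)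
  then have "frac_vec s = frac_vec t" using assms(1) same_slice_point by blast
  then have "t = s + int_vec (floor_vec t - floor_vec s)"
    by (simp add: frac_vec_def int_vec_simps algebra_simps)
  then show thesis using that \<omega> susp_point_shift by metis
qed

section \<open>The distance inside a slice\<close>

lemma slice_dist_point:
  "slice_dist \<phi> (susp_point \<phi> x s) (susp_point \<phi> y s) =
     (\<Sum>\<sigma>\<in>corners. corner_weight \<sigma> (frac_vec s) *
        dist (\<phi> (\<sigma> + floor_vec s) x) (\<phi> (\<sigma> + floor_vec s) y))"
  by (simp add: slice_dist_def susp_rep_point susp_normal_def corner_weight_def corners_def phi_add)

lemma slice_dist_nonneg:
  assumes "same_slice \<omega> \<omega>'" "\<omega> \<in> suspension \<phi>" "\<omega>' \<in> suspension \<phi>"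
  shows "0 \<le> slice_dist \<phi> \<omega> \<omega>'"
proof -
  obtain x s where \<omega>: "\<omega> = susp_point \<phi> x s" using assms(2) by (rule suspension_cases)
  then obtain y where "\<omega>' = susp_point \<phi> y s" using assms same_slice_imp_lift by metis
  then show ?thesis
    unfolding \<omega> by (auto simp: slice_dist_point intro!: sum_nonneg mult_nonneg_nonneg
        corner_weight_bounds frac_vec_mem)
qed

text \<open>Every weight is at most \<open>1\<close>, and a factor depending only on the dimension does no harm
  to expansiveness.\<close>

lemma slice_dist_upper:
  fixes \<delta> :: real
  assumes "\<And>n. dist (\<phi> n x) (\<phi> n y) < \<delta>"
  shows "slice_dist \<phi> (susp_point \<phi> x s) (susp_point \<phi> y s) \<le> card (corners :: (int^'d) set) * \<delta>"
proof -
  have "corner_weight \<sigma> (frac_vec s) * dist (\<phi> (\<sigma> + floor_vec s) x) (\<phi> (\<sigma> + floor_vec s) y) \<le> 1 * \<delta>"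
    if "\<sigma> \<in> corners" for \<sigma>
    using corner_weight_bounds[OF that frac_vec_mem] assms[of "\<sigma> + floor_vec s"]
    by (intro mult_mono) auto
  then have "(\<Sum>\<sigma>\<in>corners. corner_weight \<sigma> (frac_vec s) *
        dist (\<phi> (\<sigma> + floor_vec s) x) (\<phi> (\<sigma> + floor_vec s) y)) \<le> of_nat (card (corners :: (int^'d) set)) * \<delta>"
    by (intro sum_bounded_above) auto
  then show ?thesis by (simp add: slice_dist_point)
qed

text \<open>Near the integer slice of height \<open>m\<close> the corner \<open>m\<close> of the cube containing \<open>m + s\<close> carries
  a definite part of the total weight, whichever of the \<open>2\<^sup>d\<close> cubes around \<open>m\<close> this is.\<close>

lemma slice_dist_lower:
  fixes m :: "int^'d"
  assumes "norm s \<le> 1/2"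
  shows "dist (\<phi> m x) (\<phi> m y) \<le>
    2 ^ CARD('d) * slice_dist \<phi> (susp_point \<phi> x (int_vec m + s)) (susp_point \<phi> y (int_vec m + s))"
proof -
  define \<sigma> where "\<sigma> = - floor_vec s"
  have fl: "floor_vec (int_vec m + s) = m + floor_vec s" "frac_vec (int_vec m + s) = frac_vec s"
    using floor_vec_add_int_vec[of s m] frac_vec_add_int_vec[of s m] by (simp_all add: add.commute)
  have s: "\<bar>s $ i\<bar> \<le> 1/2" for i
    using component_le_norm_cart[of s i] assms by linarith
  have floor_s: "\<lfloor>s $ i\<rfloor> = 0 \<or> \<lfloor>s $ i\<rfloor> = -1" for i
    using s[of i] by linarith
  have \<sigma>: "\<sigma> \<in> corners"
    using floor_s by (force simp: corners_def \<sigma>_def)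
  have factor: "of_int (\<sigma> $ i) * frac_vec s $ i + (1 - of_int (\<sigma> $ i)) * (1 - frac_vec s $ i) \<ge> 1/2" for i
    using floor_s[of i] s[of i] by (auto simp: \<sigma>_def frac_def abs_le_iff)
  have "(\<Prod>i\<in>(UNIV::'d set). 1/2 :: real) \<le> corner_weight \<sigma> (frac_vec s)"
    unfolding corner_weight_def by (intro prod_mono) (use factor in auto)
  then have w: "1 \<le> 2 ^ CARD('d) * corner_weight \<sigma> (frac_vec s)"
    by (simp add: power_divide field_simps)
  let ?f = "\<lambda>\<sigma>. corner_weight \<sigma> (frac_vec s) *
    dist (\<phi> (\<sigma> + (m + floor_vec s)) x) (\<phi> (\<sigma> + (m + floor_vec s)) y)"
  have "?f \<sigma> \<le> sum ?f corners"
    by (rule member_le_sum[OF \<sigma>])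
      (auto intro!: finite_corners mult_nonneg_nonneg corner_weight_bounds frac_vec_mem)
  moreover have "\<sigma> + (m + floor_vec s) = m" by (simp add: \<sigma>_def)
  ultimately have le: "corner_weight \<sigma> (frac_vec s) * dist (\<phi> m x) (\<phi> m y) \<le>
      slice_dist \<phi> (susp_point \<phi> x (int_vec m + s)) (susp_point \<phi> y (int_vec m + s))"
    by (simp only: slice_dist_point fl)
  have "dist (\<phi> m x) (\<phi> m y) \<le>
      2 ^ CARD('d) * (corner_weight \<sigma> (frac_vec s) * dist (\<phi> m x) (\<phi> m y))"
    using mult_right_mono[OF w, of "dist (\<phi> m x) (\<phi> m y)"] by (simp add: mult.assoc)
  also have "\<dots> \<le> 2 ^ CARD('d) *
      slice_dist \<phi> (susp_point \<phi> x (int_vec m + s)) (susp_point \<phi> y (int_vec m + s))"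
    using le by (intro mult_left_mono) auto
  finally show ?thesis .
qed

section \<open>Chains and the distance of the suspension\<close>

lemma orbit_dist_nonneg:
  assumes "same_orbit \<phi> \<omega> \<omega>'"
  shows "0 \<le> orbit_dist \<phi> \<omega> \<omega>'"
  unfolding orbit_dist_def
  by (rule cInf_greatest) (use assms in \<open>auto simp: same_orbit_def\<close>)

lemma susp_step_nonneg:
  assumes "susp_step \<phi> \<omega> \<omega>' r" "\<omega> \<in> suspension \<phi>" "\<omega>' \<in> suspension \<phi>"
  shows "0 \<le> r"
  using assms slice_dist_nonneg orbit_dist_nonneg by (auto simp: susp_step_def)

definition susp_chain :: "nat \<Rightarrow> (nat \<Rightarrow> ('m \<times> (real^'d)) set) \<Rightarrow> (nat \<Rightarrow> real) \<Rightarrow> bool" where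
  "susp_chain n \<omega> r \<longleftrightarrow>
     (\<forall>i\<le>n. \<omega> i \<in> suspension \<phi>) \<and> (\<forall>i<n. susp_step \<phi> (\<omega> i) (\<omega> (Suc i)) (r i))"

lemma susp_dist_alt:
  "susp_dist \<phi> p q = Inf {\<Sum>i<n. r i | n \<omega> r. \<omega> 0 = p \<and> \<omega> n = q \<and> susp_chain n \<omega> r}"
  unfolding susp_dist_def susp_chain_def by simp

lemma susp_chain_sum_nonneg: "susp_chain n \<omega> r \<Longrightarrow> 0 \<le> (\<Sum>i<n. r i)"
  unfolding susp_chain_def
  by (intro sum_nonneg susp_step_nonneg) (auto simp: Suc_le_eq less_imp_le)

lemma susp_dist_le_slice_dist:
  "susp_dist \<phi> (susp_point \<phi> x s) (susp_point \<phi> y s) \<le>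
     slice_dist \<phi> (susp_point \<phi> x s) (susp_point \<phi> y s)" (is "_ \<le> ?d")
  unfolding susp_dist_alt
proof (rule cInf_lower)
  define \<omega> where "\<omega> i = (if i = 0 then susp_point \<phi> x s else susp_point \<phi> y s)" for i :: nat
  have "susp_chain 1 \<omega> (\<lambda>_. ?d)"
    by (auto simp: susp_chain_def \<omega>_def susp_point_mem susp_step_def same_slice_point)
  moreover have "?d = (\<Sum>i<1::nat. ?d)" "\<omega> 0 = susp_point \<phi> x s" "\<omega> 1 = susp_point \<phi> y s"
    by (simp_all add: \<omega>_def)
  ultimately show "?d \<in> {\<Sum>i<n. r i | n \<omega> r.
      \<omega> 0 = susp_point \<phi> x s \<and> \<omega> n = susp_point \<phi> y s \<and> susp_chain n \<omega> r}"
    by blast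
  show "bdd_below {\<Sum>i<n. r i | n \<omega> r.
      \<omega> 0 = susp_point \<phi> x s \<and> \<omega> n = susp_point \<phi> y s \<and> susp_chain n \<omega> r}"
    by (rule bdd_belowI[of _ 0]) (auto intro: susp_chain_sum_nonneg)
qed

text \<open>Any two points are joined by an orbit step into the right slice followed by a step inside that
  slice, so the infimum defining the distance is never taken over the empty set.\<close>

lemma susp_chain_exists:
  assumes "p \<in> suspension \<phi>" "q \<in> suspension \<phi>"
  obtains n \<omega> r where "\<omega> 0 = p" "\<omega> n = q" "susp_chain n \<omega> r"
proof -
  obtain x s where p: "p = susp_point \<phi> x s" using assms(1) by (rule suspension_cases)
  obtain y t where q: "q = susp_point \<phi> y t" using assms(2) by (rule suspension_cases)
  define z where "z = susp_point \<phi> x t"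
  define \<omega> where "\<omega> i = (if i = 0 then p else if i = Suc 0 then z else q)" for i :: nat
  define r where "r i = (if i = 0 then orbit_dist \<phi> p z else slice_dist \<phi> z q)" for i :: nat
  have "susp_flow \<phi> (t - s) p = z" by (simp add: p z_def susp_flow_point)
  then have "susp_step \<phi> p z (orbit_dist \<phi> p z)" by (auto simp: susp_step_def same_orbit_def)
  moreover have "susp_step \<phi> z q (slice_dist \<phi> z q)"
    by (simp add: susp_step_def z_def q same_slice_point)
  ultimately have "susp_chain 2 \<omega> r"
    using assms by (auto simp: susp_chain_def \<omega>_def r_def z_def susp_point_mem less_2_cases_iff)
  then show thesis by (intro that[of \<omega> 2 r]) (simp_all add: \<omega>_def)
qed

lemma susp_dist_less_chain:
  assumes "susp_dist \<phi> p q < \<delta>" "p \<in> suspension \<phi>" "q \<in> suspension \<phi>"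
  obtains n \<omega> r where "\<omega> 0 = p" "\<omega> n = q" "susp_chain n \<omega> r" "(\<Sum>i<n. r i) < \<delta>"
proof -
  let ?S = "{\<Sum>i<n. r i | n \<omega> r. \<omega> 0 = p \<and> \<omega> n = q \<and> susp_chain n \<omega> r}"
  have "?S \<noteq> {}" using susp_chain_exists[OF assms(2,3)] by (smt (verit) Collect_empty_eq)
  then obtain c where "c \<in> ?S" "c < \<delta>"
    using cInf_lessD[of ?S \<delta>] assms(1) unfolding susp_dist_alt by blast
  then show thesis using that by blast
qed

text \<open>The norm of the translation is only bounded up to \<open>e\<close> because the cost of an orbit step is an
  infimum.\<close>

lemma susp_step_lift:
  assumes "susp_step \<phi> (susp_point \<phi> x s) \<omega> r" "\<omega> \<in> suspension \<phi>" "e > 0"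
  obtains (slice) y where "\<omega> = susp_point \<phi> y s" "r = slice_dist \<phi> (susp_point \<phi> x s) (susp_point \<phi> y s)"
    | (orbit) v where "\<omega> = susp_point \<phi> x (s + v)" "norm v < r + e"
  using assms(1) unfolding susp_step_def
proof (elim disjE conjE)
  assume "same_slice (susp_point \<phi> x s) \<omega>" "r = slice_dist \<phi> (susp_point \<phi> x s) \<omega>"
  then show thesis using same_slice_imp_lift[OF _ assms(2)] slice by metis
next
  let ?S = "{norm v | v. susp_flow \<phi> v (susp_point \<phi> x s) = \<omega>}"
  assume *: "same_orbit \<phi> (susp_point \<phi> x s) \<omega>" "r = orbit_dist \<phi> (susp_point \<phi> x s) \<omega>"
  then have "?S \<noteq> {}" "Inf ?S < r + e"
    using assms(3) by (auto simp: same_orbit_def orbit_dist_def)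
  then obtain c where "c \<in> ?S" "c < r + e" using cInf_lessD[of ?S "r + e"] by blast
  then show thesis using orbit by (auto simp: susp_flow_point)
qed

text \<open>A chain is lifted to \<open>M \<times> \<real>\<^sup>d\<close>: its orbit steps move only the second coordinate, its slice
  steps only the first one. As long as the second coordinate stays close to the integer vector \<open>m\<close>,
  the weight of the corner \<open>m\<close> turns the cost of the slice steps into a bound for the distance
  between the first coordinates, seen at time \<open>m\<close>.\<close>

lemma susp_chain_lift:
  fixes u :: "real^'d" and e :: real
  assumes "susp_chain n \<omega> r" "\<omega> 0 = susp_point \<phi> x u" "e > 0" "k \<le> n"
  shows "\<exists>y s. \<omega> k = susp_point \<phi> y (u + s) \<and> norm s \<le> (\<Sum>i<k. r i) + real k * e \<and>
    (\<forall>m. u = int_vec m \<and> (\<Sum>i<k. r i) + real k * e \<le> 1/2 \<longrightarrow>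
       dist (\<phi> m x) (\<phi> m y) \<le> 2 ^ CARD('d) * (\<Sum>i<k. r i))"
  using assms(4)
proof (induction k)
  case 0
  show ?case by (rule exI[of _ x], rule exI[of _ 0]) (simp add: assms(2))
next
  case (Suc k)
  let ?R = "\<Sum>i<k. r i"
  obtain y s where IH: "\<omega> k = susp_point \<phi> y (u + s)" "norm s \<le> ?R + real k * e"
    "\<And>m. u = int_vec m \<Longrightarrow> ?R + real k * e \<le> 1/2 \<Longrightarrow> dist (\<phi> m x) (\<phi> m y) \<le> 2 ^ CARD('d) * ?R"
    using Suc by auto
  have step: "susp_step \<phi> (susp_point \<phi> y (u + s)) (\<omega> (Suc k)) (r k)"
    and mem: "\<omega> k \<in> suspension \<phi>" "\<omega> (Suc k) \<in> suspension \<phi>"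
    using assms(1) Suc.prems IH(1)[symmetric] unfolding susp_chain_def by (auto simp: Suc_le_eq)
  have r: "0 \<le> r k" using susp_step_nonneg[OF step] mem IH(1) by simp
  have ke: "real (Suc k) * e = real k * e + e" by (simp add: algebra_simps)
  from step mem(2) assms(3) show ?case
  proof (cases rule: susp_step_lift)
    case (slice z)
    have "dist (\<phi> m x) (\<phi> m z) \<le> 2 ^ CARD('d) * (\<Sum>i<Suc k. r i)"
      if "u = int_vec m" "(\<Sum>i<Suc k. r i) + real (Suc k) * e \<le> 1/2" for m
    proof -
      have small: "?R + real k * e \<le> 1/2" using that(2) r assms(3) ke by simp
      have "dist (\<phi> m y) (\<phi> m z) \<le> 2 ^ CARD('d) * r k"
        using slice_dist_lower[of s m y z] small IH(2) slice(2) that(1) by simp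
      then have "dist (\<phi> m x) (\<phi> m z) \<le> 2 ^ CARD('d) * ?R + 2 ^ CARD('d) * r k"
        using IH(3)[OF that(1) small] dist_triangle[of "\<phi> m x" "\<phi> m z" "\<phi> m y"] by linarith
      then show ?thesis by (simp add: distrib_left)
    qed
    moreover have "norm s \<le> (\<Sum>i<Suc k. r i) + real (Suc k) * e" using IH(2) r assms(3) ke by simp
    ultimately show ?thesis using slice(1) by blast
  next
    case (orbit v)
    have "dist (\<phi> m x) (\<phi> m y) \<le> 2 ^ CARD('d) * (\<Sum>i<Suc k. r i)"
      if "u = int_vec m" "(\<Sum>i<Suc k. r i) + real (Suc k) * e \<le> 1/2" for m
    proof -
      have "?R + real k * e \<le> 1/2" using that(2) r assms(3) ke by simp
      then have "dist (\<phi> m x) (\<phi> m y) \<le> 2 ^ CARD('d) * ?R" using IH(3) that(1) by blast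
      then show ?thesis using r by (simp add: distrib_left add_increasing2)
    qed
    moreover have "norm (s + v) \<le> (\<Sum>i<Suc k. r i) + real (Suc k) * e"
      using norm_triangle_ineq[of s v] IH(2) orbit(2) ke by simp
    moreover have "\<omega> (Suc k) = susp_point \<phi> y (u + (s + v))" using orbit(1) by (simp add: add.assoc)
    ultimately show ?thesis by blast
  qed
qed

text \<open>The form in which the metric enters the expansiveness of the flow: points near a point of
  height \<open>u\<close> have lifts of height near \<open>u\<close> and, if \<open>u\<close> is an integer vector, also nearby base
  points.\<close>

lemma susp_dist_less_lift:
  fixes u :: "real^'d"
  assumes "susp_dist \<phi> (susp_point \<phi> x u) q < \<delta>" "q \<in> suspension \<phi>" "\<delta> \<le> 1/2"
  obtains y s where "q = susp_point \<phi> y (u + s)" "norm s < \<delta>"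
    "\<And>m. u = int_vec m \<Longrightarrow> dist (\<phi> m x) (\<phi> m y) \<le> 2 ^ CARD('d) * \<delta>"
proof -
  obtain n \<omega> r where chain: "\<omega> 0 = susp_point \<phi> x u" "\<omega> n = q" "susp_chain n \<omega> r"
    and R: "(\<Sum>i<n. r i) < \<delta>"
    using susp_dist_less_chain[OF assms(1) susp_point_mem assms(2)] by metis
  define e where "e = (\<delta> - (\<Sum>i<n. r i)) / (real n + 1)"
  have e: "e > 0" using R by (simp add: e_def)
  have "(real n + 1) * e = \<delta> - (\<Sum>i<n. r i)" by (simp add: e_def)
  then have ne: "(\<Sum>i<n. r i) + real n * e < \<delta>" using e by (simp add: algebra_simps)
  obtain y s where ys: "q = susp_point \<phi> y (u + s)" "norm s \<le> (\<Sum>i<n. r i) + real n * e"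
    "\<And>m. u = int_vec m \<Longrightarrow> (\<Sum>i<n. r i) + real n * e \<le> 1/2 \<Longrightarrow>
       dist (\<phi> m x) (\<phi> m y) \<le> 2 ^ CARD('d) * (\<Sum>i<n. r i)"
    using susp_chain_lift[OF chain(3,1) e order_refl] chain(2) by blast
  have "2 ^ CARD('d) * (\<Sum>i<n. r i) \<le> 2 ^ CARD('d) * \<delta>" using R by simp
  then have "dist (\<phi> m x) (\<phi> m y) \<le> 2 ^ CARD('d) * \<delta>" if "u = int_vec m" for m
    using ys(3)[OF that] ne assms(3) by linarith
  then show thesis using that ys(1,2) ne by force
qed

section \<open>Expansiveness\<close>

text \<open>Distinct integer vectors have distance at least \<open>1\<close>, so \<open>k\<close> can only jump where \<open>g\<close>
  jumps by at least \<open>1/2\<close>.\<close>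

lemma int_vec_near_continuous_constant:
  fixes g :: "real^'d \<Rightarrow> real^'d"
  assumes "continuous_on UNIV g" "\<And>v. norm (g v - int_vec (k v)) < 1/4"
  shows "k v = k 0"
proof -
  have "k constant_on UNIV"
  proof (rule locally_constant_imp_constant)
    show "\<exists>T. openin (top_of_set UNIV) T \<and> v \<in> T \<and> (\<forall>w\<in>T. k w = k v)" for v
    proof (intro exI conjI ballI)
      let ?T = "g -` ball (g v) (1/2)"
      show "openin (top_of_set UNIV) ?T"
        using assms(1) by (simp add: open_vimage continuous_on_eq_continuous_at)
      show "v \<in> ?T" by simp
      fix w assume "w \<in> ?T"
      then have "norm (g v - g w) < 1/2" by (simp add: dist_norm)
      moreover have eq: "int_vec (k w) - int_vec (k v) =
          (g v - int_vec (k v)) - (g w - int_vec (k w)) - (g v - g w)" by simp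
      ultimately have "norm (int_vec (k w) - int_vec (k v)) < 1"
        unfolding eq using assms(2)[of v] assms(2)[of w]
          norm_triangle_ineq4[of "(g v - int_vec (k v)) - (g w - int_vec (k w))" "g v - g w"]
          norm_triangle_ineq4[of "g v - int_vec (k v)" "g w - int_vec (k w)"] by linarith
      then show "k w = k v" by (rule int_vec_eq_if_close)
    qed
  qed auto
  then show ?thesis by (auto simp: constant_on_def)
qed

text \<open>The base points \<open>x\<close> and \<open>y\<close> are placed at height \<open>0\<close>. The identity serves as the
  reparametrization, and a point of the same slice that is reached by a translation of norm less
  than \<open>1\<close> is reached by the zero translation.\<close>

lemma Zd_expansive_if_Rd_expansive:
  assumes "Rd_expansive (suspension \<phi>) (susp_dist \<phi>) (susp_flow \<phi>)"
  shows "Zd_expansive \<phi>"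
proof -
  obtain \<delta> where \<delta>: "\<delta> > 0"
    and ex: "\<And>p q h. p \<in> suspension \<phi> \<Longrightarrow> q \<in> suspension \<phi> \<Longrightarrow> continuous_on UNIV h \<Longrightarrow> h 0 = 0 \<Longrightarrow>
       (\<forall>v. susp_dist \<phi> (susp_flow \<phi> v p) (susp_flow \<phi> (h v) q) < \<delta>) \<Longrightarrow>
       \<exists>v0. norm v0 < 1 \<and> q = susp_flow \<phi> v0 p"
    using assms[unfolded Rd_expansive_def, rule_format, of 1] by (auto; blast)
  define N where "N = card (corners :: (int^'d) set)"
  \<comment> \<open>Adding \<open>1\<close> turns the non-strict bound by \<open>N\<close> terms into a strict one.\<close>
  define \<delta>' where "\<delta>' = \<delta> / (real N + 1)"
  have "\<delta>' > 0" using \<delta> by (simp add: \<delta>'_def)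
  have "(real N + 1) * \<delta>' = \<delta>" by (simp add: \<delta>'_def)
  then have N\<delta>': "real N * \<delta>' < \<delta>" using \<open>\<delta>' > 0\<close> by (simp add: algebra_simps)
  have "x = y" if close: "\<forall>n. dist (\<phi> n x) (\<phi> n y) < \<delta>'" for x y
  proof -
    have "susp_dist \<phi> (susp_flow \<phi> v (susp_point \<phi> x 0)) (susp_flow \<phi> v (susp_point \<phi> y 0)) < \<delta>" for v
      using susp_dist_le_slice_dist[of x v y] slice_dist_upper[of x y \<delta>' v] close N\<delta>'
      by (simp add: susp_flow_point N_def)
    then obtain v0 where v0: "norm v0 < 1" "susp_point \<phi> y 0 = susp_point \<phi> x v0"
      using ex[of "susp_point \<phi> x 0" "susp_point \<phi> y 0" "\<lambda>v. v"]
      by (auto simp: susp_point_mem susp_flow_point)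
    then have "frac_vec v0 = 0"
      by (simp add: susp_point_eq_iff susp_normal_def half_open_cube_fixed half_open_cube_def)
    then have v0_int: "v0 = int_vec (floor_vec v0)" by (metis add_0 frac_vec_decomp)
    have "floor_vec v0 = 0"
    proof (rule int_vec_eq_if_close)
      show "norm (int_vec (floor_vec v0) - int_vec 0 :: real^'d) < 1"
        using v0(1) v0_int by (simp add: int_vec_simps)
    qed
    then have "v0 = 0" using v0_int by (simp add: int_vec_simps)
    then show ?thesis using v0(2) susp_point_inj by metis
  qed
  then show ?thesis unfolding Zd_expansive_def using \<open>\<delta>' > 0\<close> by blast
qed

text \<open>Closeness of the orbits forces \<open>h v\<close> to stay near \<open>v + c\<close> for a fixed vector \<open>c\<close>, which
  makes it possible to compare the two lifted orbits at equal heights.\<close>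

lemma Rd_expansive_if_Zd_expansive:
  assumes "Zd_expansive \<phi>"
  shows "Rd_expansive (suspension \<phi>) (susp_dist \<phi>) (susp_flow \<phi>)"
proof -
  obtain \<delta>0 where \<delta>0: "\<delta>0 > 0" "\<And>x y. (\<And>n. dist (\<phi> n x) (\<phi> n y) < \<delta>0) \<Longrightarrow> x = y"
    using assms unfolding Zd_expansive_def by blast
  show ?thesis
    unfolding Rd_expansive_def
  proof (intro allI impI)
    fix \<epsilon> :: real assume \<epsilon>: "\<epsilon> > 0"
    \<comment> \<open>\<open>1/4\<close> leaves no doubt about the nearest integer vector, and \<open>2 ^ CARD('d)\<close> is the
      factor lost when the displacement in \<open>M\<close> is bounded by the cost of a chain.\<close>
    define \<delta> where "\<delta> = min \<epsilon> (min (1/4) (\<delta>0 / (2 * 2 ^ CARD('d))))"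
    have \<delta>: "\<delta> > 0" "\<delta> \<le> \<epsilon>" "\<delta> \<le> 1/4" "2 ^ CARD('d) * \<delta> < \<delta>0"
    proof -
      show "\<delta> > 0" "\<delta> \<le> \<epsilon>" "\<delta> \<le> 1/4" using \<epsilon> \<delta>0(1) by (auto simp: \<delta>_def)
      have "\<delta> \<le> \<delta>0 / (2 * 2 ^ CARD('d))" by (simp add: \<delta>_def)
      then have "2 ^ CARD('d) * \<delta> \<le> \<delta>0 / 2" by (simp add: field_simps)
      then show "2 ^ CARD('d) * \<delta> < \<delta>0" using \<delta>0(1) by linarith
    qed
    have "\<exists>v0. norm v0 < \<epsilon> \<and> q = susp_flow \<phi> v0 p"
      if pq: "p \<in> suspension \<phi>" "q \<in> suspension \<phi>" and h: "continuous_on UNIV h" "h 0 = 0"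
        and close: "\<And>v. susp_dist \<phi> (susp_flow \<phi> v p) (susp_flow \<phi> (h v) q) < \<delta>"
      for p q and h :: "real^'d \<Rightarrow> real^'d"
    proof -
      obtain x a where p: "p = susp_point \<phi> x a" using pq(1) by (rule suspension_cases)
      obtain y b where q: "q = susp_point \<phi> y b" using pq(2) by (rule suspension_cases)
      have "\<exists>z s. susp_point \<phi> y (b + h v) = susp_point \<phi> z (a + v + s) \<and> norm s < \<delta> \<and>
          (\<forall>m. a + v = int_vec m \<longrightarrow> dist (\<phi> m x) (\<phi> m z) \<le> 2 ^ CARD('d) * \<delta>)" for v
      proof -
        have "susp_dist \<phi> (susp_point \<phi> x (a + v)) (susp_point \<phi> y (b + h v)) < \<delta>"
          using close[of v] by (simp add: p q susp_flow_point)
        then show ?thesis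
          using \<delta>(3) by (elim susp_dist_less_lift) (auto intro: susp_point_mem)
      qed
      then obtain z s where zs: "\<And>v. susp_point \<phi> y (b + h v) = susp_point \<phi> (z v) (a + v + s v)"
        "\<And>v. norm (s v) < \<delta>"
        "\<And>v m. a + v = int_vec m \<Longrightarrow> dist (\<phi> m x) (\<phi> m (z v)) \<le> 2 ^ CARD('d) * \<delta>"
        by metis
      define g where "g v = b + h v - a - v" for v
      define k where "k v = floor_vec (b + h v) - floor_vec (a + v + s v)" for v
      have g: "g v - int_vec (k v) = s v" for v
      proof -
        have "frac_vec (b + h v) = frac_vec (a + v + s v)"
          using zs(1)[of v] by (simp add: susp_point_eq_iff susp_normal_def)
        then show ?thesis
          unfolding frac_vec_def g_def k_def int_vec_simps by (simp add: algebra_simps)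
      qed
      \<comment> \<open>The heights of the two lifted orbits differ by \<open>g v\<close>. This is close to an integer
        vector, which cannot jump, so one deck transformation \<open>k 0\<close> serves all times.\<close>
      have k: "k v = k 0" for v
      proof (rule int_vec_near_continuous_constant)
        show "continuous_on UNIV g" unfolding g_def using h(1) by (intro continuous_intros)
        show "norm (g v - int_vec (k v)) < 1/4" for v using g zs(2)[of v] \<delta>(3) by simp
      qed
      have z: "z v = \<phi> (k 0) y" for v
      proof -
        have "b + h v = a + v + s v + int_vec (k 0)"
          using g[of v] k[of v] by (simp add: g_def algebra_simps)
        then show ?thesis using zs(1)[of v] by (simp add: susp_point_shift susp_point_inj)
      qed
      \<comment> \<open>At time \<open>m - a\<close> the orbit of \<open>p\<close> passes through the integer height \<open>m\<close>.\<close>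
      have "dist (\<phi> m x) (\<phi> m (\<phi> (k 0) y)) < \<delta>0" for m
        using zs(3)[of "int_vec m - a" m] z \<delta>(4) by simp
      then have x: "x = \<phi> (k 0) y" by (rule \<delta>0(2))
      have "b = a + s 0 + int_vec (k 0)"
        using g[of 0] h(2) by (simp add: g_def algebra_simps)
      then have "q = susp_flow \<phi> (s 0) p"
        by (simp add: p q x susp_flow_point susp_point_shift)
      then show ?thesis using zs(2)[of 0] \<delta>(2) by (intro exI[of _ "s 0"]) auto
    qed
    then show "\<exists>\<delta>>0. \<forall>x\<in>suspension \<phi>. \<forall>y\<in>suspension \<phi>.
        (\<exists>h. continuous_on UNIV h \<and> h 0 = 0 \<and>
           (\<forall>v. susp_dist \<phi> (susp_flow \<phi> v x) (susp_flow \<phi> (h v) y) < \<delta>)) \<longrightarrow>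
        (\<exists>v0. norm v0 < \<epsilon> \<and> y = susp_flow \<phi> v0 x)"
      using \<delta>(1) by blast
  qed
qed

end

theorem theorem4p1:
  fixes \<phi> :: "int^'d \<Rightarrow> 'm::metric_space \<Rightarrow> 'm"
    and A :: "('m, 'e::euclidean_space) chart set"
    and g :: "('m, 'e) chart \<Rightarrow> 'm \<Rightarrow> 'e \<Rightarrow> 'e \<Rightarrow> real"
  assumes "CARD('d) \<ge> 2"
    and "compact_riemannian_manifold A g"
    and "Zd_action \<phi>"
    and "bi_lipschitz_action \<phi>"
  shows "Zd_expansive \<phi> \<longleftrightarrow> Rd_expansive (suspension \<phi>) (susp_dist \<phi>) (susp_flow \<phi>)"
proof -
  interpret Zd_act \<phi> by unfold_locales (rule assms(3))
  show ?thesis using Zd_expansive_if_Rd_expansive Rd_expansive_if_Zd_expansive by blast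
qed

end
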